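(* Let $\rho>1/2$ and $\epsilon>0$ be real, let $\delta_{1\rho},\delta_{2\rho}$ be real numbers satisfying $$\frac{\pi}{2\rho}<\delta_{1\rho}\leqslant\min\left(\pi,\frac{\pi}{\rho}\right),\qquad \frac{\pi}{2\rho}<\delta_{2\rho}\leqslant\min\left(\pi,\frac{\pi}{\rho}\right),$$ let $\mu\in\mathbb{C}$, and let $z\in\mathbb{C}$ satisfy $$\frac{\pi}{2\rho}-\delta_{2\rho}+\pi<\arg z<-\frac{\pi}{2\rho}+\delta_{1\rho}+\pi.$$ Then the Mittag-Leffler function $E_{\rho,\mu}$ can be represented in the form $$E_{\rho,\mu}(z)=\int_{1+\epsilon}^{\infty}K_{\rho,\mu}(r,-\delta_{1\rho},\delta_{2\rho},z)\,dr+\int_{-\delta_{1\rho}-\pi}^{\delta_{2\rho}-\pi}P_{\rho,\mu}(1+\epsilon,\varphi,z)\,d\varphi.$$ Here $$K_{\rho,\mu}(r,\varphi_1,\varphi_2,z)=\frac{\rho}{2\pi i}\,\frac{(zr)^{\rho(1-\mu)}e^{-i\rho\pi(1-\mu)}\left[A_{\rho,\mu}(r,\varphi_2,\varphi_1,z)-A_{\rho,\mu}(r,\varphi_1,\varphi_2,z)\right]}{(r^2+2r\cos\varphi_1+1)(r^2+2r\cos\varphi_2+1)},$$ where $$A_{\rho,\mu}(r,\omega_1,\omega_2,z)=\exp\left\{(zr)^\rho e^{-i\rho\pi}\cos(\rho\omega_1)\right\}(r^2+2r\cos\omega_2+1)\,e^{i\eta(r,\omega_1,z)}\left[r+e^{i\omega_1}\right],$$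 $$\eta(r,\varphi,z)=(zr)^{\rho}e^{-i\rho\pi}\sin(\rho\varphi)+\rho(1-\mu)\varphi,$$ and $$P_{\rho,\mu}(r,\varphi,z)=\frac{\rho}{2\pi}\,\frac{\exp\left\{(zr)^\rho\cos(\rho\varphi)\right\}(zr)^{\rho(1-\mu)}e^{i\chi(r,\varphi,z)}\,r\left[r-e^{i\varphi}\right]}{r^2-2r\cos\varphi+1},$$ where $$\chi(r,\varphi,z)=(zr)^\rho\sin(\rho\varphi)+\rho(1-\mu)\varphi.$$
   Context: The two-parameter Mittag-Leffler function is the entire function of $z$ defined, for real $\rho>0$ and $\mu\in\mathbb{C}$, by $E_{\rho,\mu}(z)=\sum_{k=0}^{\infty}\frac{z^k}{\Gamma(\mu+k/\rho)}$, where $1/\Gamma$ is taken to be $0$ at the poles of $\Gamma$. Convention on powers: $z\neq0$ is written $z=|z|e^{i\arg z}$ with $\arg z$ the value of the argument lying in the interval prescribed in the hypothesis (this interval is contained in $(0,2\pi)$), and for $r>0$ and $a\in\mathbb{C}$, $(zr)^{a}=\exp\{a(\ln(|z|r)+i\arg z)\}$. *)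

theory Defs
  imports "HOL-Analysis.Analysis"
begin

text \<open>\<^const>\<open>rGamma\<close> is the reciprocal Gamma function, which vanishes at the poles of Gamma.\<close>

definition mittag_leffler :: "real \<Rightarrow> complex \<Rightarrow> complex \<Rightarrow> complex" where
  "mittag_leffler \<rho> \<mu> z = (\<Sum>k. z ^ k * rGamma (\<mu> + of_real (real k / \<rho>)))"

text \<open>
  The power \<open>(z r)\<^sup>a\<close> for \<open>z \<noteq> 0\<close> and \<open>r > 0\<close>, with the argument of \<open>z\<close> taken in \<open>[0, 2\<pi>)\<close>.
  It is not \<^term>\<open>(z * of_real r) powr a\<close>, which uses the argument in \<open>(-\<pi>, \<pi>]\<close>.
\<close>

definition pow_arg2pi :: "complex \<Rightarrow> real \<Rightarrow> complex \<Rightarrow> complex" where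
  "pow_arg2pi z r a = exp (a * (of_real (ln (cmod z * r)) + \<i> * of_real (Arg2pi z)))"

definition eta_ml :: "real \<Rightarrow> complex \<Rightarrow> real \<Rightarrow> real \<Rightarrow> complex \<Rightarrow> complex" where
  "eta_ml \<rho> \<mu> r \<phi> z =
     pow_arg2pi z r (of_real \<rho>) * exp (- \<i> * of_real (\<rho> * pi)) * of_real (sin (\<rho> * \<phi>))
     + of_real \<rho> * (1 - \<mu>) * of_real \<phi>"

definition chi_ml :: "real \<Rightarrow> complex \<Rightarrow> real \<Rightarrow> real \<Rightarrow> complex \<Rightarrow> complex" where
  "chi_ml \<rho> \<mu> r \<phi> z =
     pow_arg2pi z r (of_real \<rho>) * of_real (sin (\<rho> * \<phi>)) + of_real \<rho> * (1 - \<mu>) * of_real \<phi>"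

definition A_ml :: "real \<Rightarrow> complex \<Rightarrow> real \<Rightarrow> real \<Rightarrow> real \<Rightarrow> complex \<Rightarrow> complex" where
  "A_ml \<rho> \<mu> r \<omega>1 \<omega>2 z =
     exp (pow_arg2pi z r (of_real \<rho>) * exp (- \<i> * of_real (\<rho> * pi)) * of_real (cos (\<rho> * \<omega>1)))
     * of_real (r\<^sup>2 + 2 * r * cos \<omega>2 + 1)
     * exp (\<i> * eta_ml \<rho> \<mu> r \<omega>1 z)
     * (of_real r + exp (\<i> * of_real \<omega>1))"

definition K_ml :: "real \<Rightarrow> complex \<Rightarrow> real \<Rightarrow> real \<Rightarrow> real \<Rightarrow> complex \<Rightarrow> complex" where
  "K_ml \<rho> \<mu> r \<phi>1 \<phi>2 z =
     of_real \<rho> / (2 * of_real pi * \<i>)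
     * (pow_arg2pi z r (of_real \<rho> * (1 - \<mu>)) * exp (- \<i> * of_real \<rho> * of_real pi * (1 - \<mu>))
        * (A_ml \<rho> \<mu> r \<phi>2 \<phi>1 z - A_ml \<rho> \<mu> r \<phi>1 \<phi>2 z))
     / of_real ((r\<^sup>2 + 2 * r * cos \<phi>1 + 1) * (r\<^sup>2 + 2 * r * cos \<phi>2 + 1))"

definition P_ml :: "real \<Rightarrow> complex \<Rightarrow> real \<Rightarrow> real \<Rightarrow> complex \<Rightarrow> complex" where
  "P_ml \<rho> \<mu> r \<phi> z =
     of_real (\<rho> / (2 * pi))
     * (exp (pow_arg2pi z r (of_real \<rho>) * of_real (cos (\<rho> * \<phi>)))
        * pow_arg2pi z r (of_real \<rho> * (1 - \<mu>))
        * exp (\<i> * chi_ml \<rho> \<mu> r \<phi> z)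
        * of_real r * (of_real r - exp (\<i> * of_real \<phi>)))
     / of_real (r\<^sup>2 - 2 * r * cos \<phi> + 1)"

end

theory Submission
  imports Defs "HOL-Complex_Analysis.Cauchy_Integral_Theorem"
begin

text \<open>
Write \<open>m = |z|\<close>, \<open>\<theta> = arg z\<close> and \<open>\<zeta> = z r e\<^sup>i\<^sup>\<phi>\<close>. With \<open>\<phi>\<^sub>1 = -\<delta>\<^sub>1 - \<pi>\<close> and
\<open>\<phi>\<^sub>2 = \<delta>\<^sub>2 - \<pi>\<close>, the right-hand side is the parametrised form of the classical contour integral
\<open>\<rho>/(2\<pi>i) \<integral> exp(\<zeta>\<^sup>\<rho>) \<zeta>\<^bsup>\<rho>(1-\<mu>)\<^esup> / (\<zeta> - z) d\<zeta>\<close> over a contour that comes in from infinity along the ray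
\<open>\<phi> = \<phi>\<^sub>1\<close>, follows the arc \<open>r = 1 + \<epsilon>\<close> and goes out along the ray \<open>\<phi> = \<phi>\<^sub>2\<close>: the arc contributes \<open>P\<close>,
and the two rays together contribute \<open>K\<close>. On the whole contour \<open>|\<zeta>| \<ge> (1 + \<epsilon>)|z|\<close>, so the Cauchy kernel is
a uniformly convergent geometric series in \<open>z/\<zeta>\<close>. Integrating term by term, it remains to evaluate
\<open>\<rho>/(2\<pi>i) \<integral> exp(\<zeta>\<^sup>\<rho>) \<zeta>\<^bsup>\<rho>(1-\<mu>)-k-1\<^esup> d\<zeta>\<close>; the substitution \<open>t = \<zeta>\<^sup>\<rho>\<close> turns it into Hankel's integral for
\<open>1/\<Gamma>(\<mu> + k/\<rho>)\<close>, which gives the coefficient of \<open>z\<^sup>k\<close> in the Mittag-Leffler series. The hypotheses on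
\<open>arg z\<close> and the bounds \<open>\<rho>\<delta>\<^sub>i \<le> \<pi>\<close> place the two rays in the sectors \<open>\<pi>/2 < \<plusminus> arg t < 3\<pi>/2\<close>, where \<open>e\<^sup>t\<close>
decays.

All branch questions disappear in the logarithmic coordinate \<open>w = ln t\<close>: Hankel's integrand becomes the entire
function \<open>exp(e\<^sup>w + (1 - s) w)\<close> and the contour becomes two horizontal half-lines joined by a vertical
segment. An entire function has a primitive \<open>\<Phi>\<close>, so the whole contour integral is the difference of the limits
of \<open>\<Phi>\<close> at the two ends. This difference is evaluated for
the angles \<open>\<plusminus>\<pi>\<close> in \<open>rGamma_hankel\<close>, shown not to depend on the angles in \<open>rGamma_hankel_angles\<close>, and
put into the shape of the contour above in \<open>rGamma_hankel_contour\<close>. The exchange of sum and integral is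
\<open>integral_geometric_series_sums\<close>, and the identification with \<open>K\<close> and \<open>P\<close> is done in
\<open>K_ml_eq_hankel\<close> and \<open>P_ml_eq_hankel\<close>.
\<close>

section \<open>Dominated integrals\<close>

text \<open>
An integrable majorant makes the integrals over \<open>{a..X n}\<close> converge for every sequence \<open>X\<close> tending to
infinity, so that one statement yields both integrability on the half-line and the limit of the primitive.
The primitive is only required to be continuous at \<open>a\<close>, as the integrand of the Gamma function may be
unbounded there.
\<close>

lemma dominated_FTC_at_top:
  fixes f G :: "real \<Rightarrow> 'a::euclidean_space"
  assumes cont: "continuous_on {a..} G"
    and deriv: "\<And>x. x > a \<Longrightarrow> (G has_vector_derivative f x) (at x)"
    and h: "h integrable_on {a..}"
    and le: "\<And>x. x \<ge> a \<Longrightarrow> norm (f x) \<le> h x"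
  shows "f integrable_on {a..}" and "(G \<longlongrightarrow> G a + integral {a..} f) at_top"
proof -
  have seq: "f integrable_on {a..} \<and> (\<lambda>n. G (X n)) \<longlonglongrightarrow> G a + integral {a..} f"
    if X: "filterlim X at_top sequentially" for X :: "nat \<Rightarrow> real"
  proof -
    define Y where "Y = (\<lambda>n. max a (X n))"
    define F where "F = (\<lambda>n x. if x \<in> {a..Y n} then f x else 0)"
    have int: "(F n has_integral (G (Y n) - G a)) {a..}" for n
    proof -
      have "(f has_integral (G (Y n) - G a)) {a..Y n}"
        by (rule fundamental_theorem_of_calculus_interior)
          (auto simp: Y_def intro!: deriv continuous_on_subset[OF cont])
      then show ?thesis
        unfolding F_def by (subst has_integral_restrict) auto
    qed
    have lim: "(\<lambda>n. F n x) \<longlonglongrightarrow> f x" if "x \<in> {a..}" for x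
    proof (rule tendsto_eventually)
      show "eventually (\<lambda>n. F n x = f x) sequentially"
        using X[unfolded filterlim_at_top, rule_format, of x]
        by eventually_elim (use that in \<open>auto simp: F_def Y_def\<close>)
    qed
    have bound: "norm (F n x) \<le> h x" if "x \<in> {a..}" for n x
      using le[of x] that norm_ge_zero[of "f x"] by (auto simp: F_def simp del: norm_ge_zero)
    have 1: "f integrable_on {a..}" "(\<lambda>n. integral {a..} (F n)) \<longlonglongrightarrow> integral {a..} f"
      using dominated_convergence[of F "{a..}" h f] int h bound lim by blast+
    have "(\<lambda>n. G a + integral {a..} (F n)) \<longlonglongrightarrow> G a + integral {a..} f"
      by (intro tendsto_intros 1)
    moreover have "eventually (\<lambda>n. G a + integral {a..} (F n) = G (X n)) sequentially"
      using X[unfolded filterlim_at_top, rule_format, of a]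
      by eventually_elim (use integral_unique[OF int] in \<open>auto simp: Y_def max_def\<close>)
    ultimately show ?thesis
      using 1 by (auto intro: Lim_transform_eventually)
  qed
  show "f integrable_on {a..}"
    using seq[OF filterlim_real_sequentially] by blast
  show "(G \<longlongrightarrow> G a + integral {a..} f) at_top"
    by (rule tendsto_at_topI_sequentially) (use seq in blast)
qed

text \<open>
The partial sums of the geometric series are bounded by \<open>1 / (1 - \<kappa>)\<close>, so \<open>h / (1 - \<kappa>)\<close> dominates all
partial sums of the series of integrands.
\<close>

lemma integral_geometric_series_sums:
  fixes f q :: "real \<Rightarrow> complex"
  assumes int: "\<And>k. ((\<lambda>x. f x * q x ^ k) has_integral I k) S"
    and h: "h integrable_on S" and le: "\<And>x. x \<in> S \<Longrightarrow> norm (f x) \<le> h x"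
    and q: "\<And>x. x \<in> S \<Longrightarrow> norm (q x) \<le> \<kappa>" and \<kappa>: "\<kappa> < 1"
  shows "(\<lambda>x. f x / (1 - q x)) integrable_on S"
    and "I sums integral S (\<lambda>x. f x / (1 - q x))"
proof -
  define F where "F = (\<lambda>n x. \<Sum>k<n. f x * q x ^ k)"
  have F: "(F n has_integral (\<Sum>k<n. I k)) S" for n
    unfolding F_def by (intro has_integral_sum int) auto
  have bound: "norm (F n x) \<le> h x * (1 / (1 - \<kappa>))" if x: "x \<in> S" for n x
  proof -
    have \<kappa>0: "0 \<le> \<kappa>"
      using q[OF x] norm_ge_zero order_trans by blast
    have "norm (F n x) = norm (f x) * norm (\<Sum>k<n. q x ^ k)"
      by (simp add: F_def norm_mult flip: sum_distrib_left)
    also have "norm (\<Sum>k<n. q x ^ k) \<le> (\<Sum>k<n. \<kappa> ^ k)"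
      by (rule sum_norm_le) (use q[OF x] in \<open>simp add: norm_power power_mono\<close>)
    also have "(\<Sum>k<n. \<kappa> ^ k) \<le> (\<Sum>k. \<kappa> ^ k)"
      by (rule sum_le_suminf) (use \<kappa>0 \<kappa> in auto)
    also have "\<dots> = 1 / (1 - \<kappa>)"
      using \<kappa>0 \<kappa> by (simp add: suminf_geometric)
    finally have "norm (F n x) \<le> norm (f x) * (1 / (1 - \<kappa>))"
      by (simp add: mult_left_mono)
    also have "\<dots> \<le> h x * (1 / (1 - \<kappa>))"
      by (rule mult_right_mono) (use le[OF x] \<kappa> in auto)
    finally show ?thesis .
  qed
  have lim: "(\<lambda>n. F n x) \<longlonglongrightarrow> f x / (1 - q x)" if x: "x \<in> S" for x
  proof -
    have "(\<lambda>k. q x ^ k) sums (1 / (1 - q x))"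
      by (rule geometric_sums) (use q[OF x] \<kappa> in simp)
    then have "(\<lambda>k. f x * q x ^ k) sums (f x * (1 / (1 - q x)))"
      by (rule sums_mult)
    then show ?thesis
      by (simp add: sums_def F_def)
  qed
  have "(\<lambda>x. h x * (1 / (1 - \<kappa>))) integrable_on S"
    by (rule integrable_on_mult_left[OF h])
  then have "(\<lambda>x. f x / (1 - q x)) integrable_on S \<and>
      (\<lambda>n. integral S (F n)) \<longlonglongrightarrow> integral S (\<lambda>x. f x / (1 - q x))"
    using dominated_convergence[of F S "\<lambda>x. h x * (1 / (1 - \<kappa>))" "\<lambda>x. f x / (1 - q x)"]
      F bound lim by blast
  then show "(\<lambda>x. f x / (1 - q x)) integrable_on S"
    and "I sums integral S (\<lambda>x. f x / (1 - q x))"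
    using integral_unique[OF F] by (auto simp: sums_def)
qed

section \<open>Hankel's integrand in the logarithmic coordinate\<close>

text \<open>
This is \<open>e\<^sup>t t\<^sup>-\<^sup>s dt\<close> under \<open>t = e\<^sup>w\<close>; the factor \<open>dt = e\<^sup>w dw\<close> accounts for the \<open>1\<close> in \<open>1 - s\<close>.
\<close>

definition hankel_integrand :: "complex \<Rightarrow> complex \<Rightarrow> complex" where
  "hankel_integrand s w = exp (exp w + (1 - s) * w)"

definition hankel_primitive :: "complex \<Rightarrow> (complex \<Rightarrow> complex) \<Rightarrow> bool" where
  "hankel_primitive s \<Phi> \<longleftrightarrow> (\<forall>w. (\<Phi> has_field_derivative hankel_integrand s w) (at w))"

lemma hankel_primitive_exists: obtains \<Phi> where "hankel_primitive s \<Phi>"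
proof -
  have "hankel_integrand s holomorphic_on UNIV"
    unfolding hankel_integrand_def by (intro holomorphic_intros)
  from holomorphic_convex_primitive'[OF convex_UNIV open_UNIV this]
  obtain \<Phi> where "\<And>w. (\<Phi> has_field_derivative hankel_integrand s w) (at w)"
    by auto
  then show ?thesis
    using that unfolding hankel_primitive_def by blast
qed

lemma norm_hankel_integrand:
  "norm (hankel_integrand s (of_real x + \<i> * of_real a)) =
     exp (exp x * cos a + (1 - Re s) * x + Im s * a)"
  by (simp add: hankel_integrand_def Re_exp)

text \<open>
For \<open>y \<ge> 0\<close>, replacing \<open>exp y\<close> by the smaller \<open>y\<^sup>2 / 2\<close> leaves a quadratic with maximum
\<open>p\<^sup>2 / (2 c)\<close>; the second summand of the bound covers negative \<open>y\<close>.
\<close>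

lemma linear_minus_exp_bounded_above:
  fixes c p y0 :: real
  assumes "c > 0"
  obtains C where "\<And>y. y \<ge> y0 \<Longrightarrow> p * y - c * exp y \<le> C"
proof
  fix y assume y: "y \<ge> y0"
  show "p * y - c * exp y \<le> p\<^sup>2 / (2 * c) + \<bar>p\<bar> * \<bar>y0\<bar>"
  proof (cases "y \<ge> 0")
    case True
    have "c * (y\<^sup>2 / 2) \<le> c * exp y"
      using exp_lower_Taylor_quadratic[OF True] True assms by (intro mult_left_mono) auto
    moreover have "p * y - c * (y\<^sup>2 / 2) \<le> p\<^sup>2 / (2 * c)"
    proof -
      have "p\<^sup>2 / (2 * c) - (p * y - c * (y\<^sup>2 / 2)) = (p - c * y)\<^sup>2 / (2 * c)"
        using assms by (simp add: field_simps power2_eq_square)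
      also have "\<dots> \<ge> 0"
        using assms by simp
      finally show ?thesis by simp
    qed
    moreover have "0 \<le> \<bar>p\<bar> * \<bar>y0\<bar>" by simp
    ultimately show ?thesis by linarith
  next
    case False
    have "p * y \<le> \<bar>p\<bar> * \<bar>y\<bar>"
      by (metis abs_ge_self abs_mult)
    also have "\<dots> \<le> \<bar>p\<bar> * \<bar>y0\<bar>"
      using y False by (intro mult_left_mono) auto
    moreover have "0 \<le> p\<^sup>2 / (2 * c)" "0 \<le> c * exp y"
      using assms by auto
    ultimately show ?thesis by linarith
  qed
qed

text \<open>
Along horizontal half-lines on which \<open>cos a\<close> is negative the decay is doubly exponential, hence faster than any
\<open>exp (- p x)\<close>. The constant is uniform over bounded angles with \<open>cos a \<le> - c\<close>, so the same bound
serves for moving the half-lines.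
\<close>

lemma hankel_integrand_decay:
  assumes "c > 0"
  obtains C where "\<And>x a. x \<ge> x0 \<Longrightarrow> cos a \<le> - c \<Longrightarrow> \<bar>a\<bar> \<le> M \<Longrightarrow>
    norm (hankel_integrand s (of_real x + \<i> * of_real a)) \<le> C * exp (- p * x)"
proof -
  obtain K where K: "\<And>x. x \<ge> x0 \<Longrightarrow> (1 - Re s + p) * x - c * exp x \<le> K"
    using linear_minus_exp_bounded_above[OF assms, of x0 "1 - Re s + p"] by blast
  show ?thesis
  proof
    fix x a assume x: "x \<ge> x0" and a: "cos a \<le> - c" "\<bar>a\<bar> \<le> M"
    have "exp x * cos a \<le> exp x * (- c)"
      using a by (intro mult_left_mono) auto
    moreover have "Im s * a \<le> \<bar>Im s\<bar> * M"
      using abs_ge_self[of "Im s * a"] mult_left_mono[OF a(2), of "\<bar>Im s\<bar>"] by (simp add: abs_mult)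
    ultimately have "exp x * cos a + (1 - Re s) * x + Im s * a \<le> (K + \<bar>Im s\<bar> * M) + (- p * x)"
      using K[OF x] by (simp add: algebra_simps)
    then show "norm (hankel_integrand s (of_real x + \<i> * of_real a))
        \<le> exp (K + \<bar>Im s\<bar> * M) * exp (- p * x)"
      unfolding norm_hankel_integrand by (simp flip: exp_add)
  qed
qed

text \<open>
The mean value inequality on a vertical segment, for \<open>\<Phi> w - c w\<close>. The constant \<open>c\<close> stands for the limit of
the integrand as the segment moves to infinity: \<open>1\<close> for \<open>s = 1\<close> and \<open>x \<rightarrow> -\<infinity>\<close>, and \<open>0\<close> in the other cases below.
\<close>

lemma hankel_primitive_diff_vertical:
  assumes \<Phi>: "hankel_primitive s \<Phi>"
    and B: "\<And>a. a \<in> closed_segment \<alpha> \<beta> \<Longrightarrow>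
      norm (hankel_integrand s (of_real x + \<i> * of_real a) - c) \<le> B"
  shows "norm ((\<Phi> (of_real x + \<i> * of_real \<beta>) - \<Phi> (of_real x + \<i> * of_real \<alpha>)) - c * (\<i> * of_real (\<beta> - \<alpha>)))
    \<le> B * \<bar>\<beta> - \<alpha>\<bar>"
proof -
  let ?w = "\<lambda>a. of_real x + \<i> * of_real a :: complex"
  have seg: "\<exists>a\<in>closed_segment \<alpha> \<beta>. w = ?w a" if w: "w \<in> closed_segment (?w \<alpha>) (?w \<beta>)" for w
  proof -
    obtain u where u: "w = (1 - u) *\<^sub>R ?w \<alpha> + u *\<^sub>R ?w \<beta>" and u01: "u \<in> {0..1}"
      using w unfolding closed_segment_image_interval by (rule imageE)
    have "w = ?w ((1 - u) *\<^sub>R \<alpha> + u *\<^sub>R \<beta>)"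
      unfolding u by (simp add: scaleR_conv_of_real algebra_simps)
    moreover have "(1 - u) *\<^sub>R \<alpha> + u *\<^sub>R \<beta> \<in> closed_segment \<alpha> \<beta>"
      using u01 by (auto simp: in_segment)
    ultimately show ?thesis by blast
  qed
  have "norm ((\<Phi> (?w \<beta>) - c * ?w \<beta>) - (\<Phi> (?w \<alpha>) - c * ?w \<alpha>)) \<le> B * norm (?w \<beta> - ?w \<alpha>)"
  proof (rule field_differentiable_bound)
    fix w assume w: "w \<in> closed_segment (?w \<alpha>) (?w \<beta>)"
    have "(\<Phi> has_field_derivative hankel_integrand s w) (at w within closed_segment (?w \<alpha>) (?w \<beta>))"
      using \<Phi> unfolding hankel_primitive_def by (blast intro: has_field_derivative_at_within)
    then show "((\<lambda>w. \<Phi> w - c * w) has_field_derivative (hankel_integrand s w - c))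
        (at w within closed_segment (?w \<alpha>) (?w \<beta>))"
      by (auto intro!: derivative_eq_intros)
    show "norm (hankel_integrand s w - c) \<le> B"
      using seg[OF w] B by auto
  qed auto
  moreover have "?w \<beta> - ?w \<alpha> = \<i> * of_real (\<beta> - \<alpha>)"
    by (simp add: algebra_simps)
  moreover have "norm (\<i> * of_real (\<beta> - \<alpha>) :: complex) = \<bar>\<beta> - \<alpha>\<bar>"
    by (simp only: norm_mult norm_of_real) simp
  moreover have "(\<Phi> (?w \<beta>) - c * ?w \<beta>) - (\<Phi> (?w \<alpha>) - c * ?w \<alpha>) =
      (\<Phi> (?w \<beta>) - \<Phi> (?w \<alpha>)) - c * (?w \<beta> - ?w \<alpha>)"
    by (simp add: algebra_simps)
  ultimately show ?thesis by metis
qed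

text \<open>
The vertical segment between the two points has fixed length, and on it the integrand tends to \<open>0\<close> uniformly,
since \<open>cos\<close> attains a negative maximum between the two angles. This is what allows the rays of Hankel's contour
to be rotated.
\<close>

lemma hankel_primitive_limit_angle_indep:
  assumes \<Phi>: "hankel_primitive s \<Phi>"
    and neg: "\<And>a. a \<in> closed_segment \<alpha> \<beta> \<Longrightarrow> cos a < 0"
  shows "((\<lambda>x. \<Phi> (of_real x + \<i> * of_real \<beta>) - \<Phi> (of_real x + \<i> * of_real \<alpha>)) \<longlongrightarrow> 0) at_top"
proof -
  obtain a0 where a0: "a0 \<in> closed_segment \<alpha> \<beta>" "\<And>a. a \<in> closed_segment \<alpha> \<beta> \<Longrightarrow> cos a \<le> cos a0"
    using continuous_attains_sup[OF compact_segment _ continuous_on_cos[OF continuous_on_id], of \<alpha> \<beta>]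
    by force
  define c where "c = - cos a0"
  have "c > 0" using neg[OF a0(1)] by (simp add: c_def)
  then obtain C where C: "\<And>x a. x \<ge> 0 \<Longrightarrow> cos a \<le> - c \<Longrightarrow> \<bar>a\<bar> \<le> \<bar>\<alpha>\<bar> + \<bar>\<beta>\<bar> \<Longrightarrow>
    norm (hankel_integrand s (of_real x + \<i> * of_real a)) \<le> C * exp (- 1 * x)"
    using hankel_integrand_decay by blast
  have "eventually (\<lambda>x. norm (\<Phi> (of_real x + \<i> * of_real \<beta>) - \<Phi> (of_real x + \<i> * of_real \<alpha>))
      \<le> C * exp (- 1 * x) * \<bar>\<beta> - \<alpha>\<bar>) at_top"
    using eventually_ge_at_top[of 0]
  proof eventually_elim
    case (elim x)
    have "\<bar>a\<bar> \<le> \<bar>\<alpha>\<bar> + \<bar>\<beta>\<bar>" if "a \<in> closed_segment \<alpha> \<beta>" for a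
      using that by (auto simp: closed_segment_eq_real_ivl split: if_splits)
    then show ?case
      using hankel_primitive_diff_vertical[OF \<Phi>, of \<alpha> \<beta> x 0 "C * exp (- 1 * x)"] C[of x] a0 elim
      by (simp add: c_def)
  qed
  moreover have "((\<lambda>x. C * exp (- 1 * x) * \<bar>\<beta> - \<alpha>\<bar>) \<longlongrightarrow> 0) at_top"
  proof -
    have "((\<lambda>x::real. exp (- x)) \<longlongrightarrow> 0) at_top"
      by (rule filterlim_compose[OF exp_at_bot filterlim_uminus_at_bot_at_top])
    then have "((\<lambda>x. C * exp (- x) * \<bar>\<beta> - \<alpha>\<bar>) \<longlongrightarrow> C * 0 * \<bar>\<beta> - \<alpha>\<bar>) at_top"
      by (intro tendsto_intros)
    then show ?thesis by simp
  qed
  ultimately show ?thesis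
    by (rule Lim_null_comparison)
qed

section \<open>Hankel's formula for the reciprocal Gamma function\<close>

lemma hankel_primitive_has_vector_derivative:
  assumes \<Phi>: "hankel_primitive s \<Phi>"
    and w: "(w has_vector_derivative w') (at x)"
  shows "((\<lambda>x. \<Phi> (w x)) has_vector_derivative (w' * hankel_integrand s (w x))) (at x)"
proof -
  have "(\<Phi> has_field_derivative hankel_integrand s (w x)) (at (w x))"
    using \<Phi> by (simp add: hankel_primitive_def)
  from field_vector_diff_chain_at[OF w this] show ?thesis
    by (simp add: o_def)
qed

text \<open>
For \<open>Re s < 1\<close> the contour can be collapsed onto the negative real axis. In terms of \<open>t = e\<^sup>x\<close>, the difference
of the two values of the primitive is \<open>E t\<close>, which tends to \<open>0\<close> as \<open>t \<rightarrow> 0\<close> and has derivative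
\<open>2 i sin(\<pi> s) t\<^sup>-\<^sup>s e\<^sup>-\<^sup>t\<close>. So its limit at infinity is \<open>2 i sin(\<pi> s) \<Gamma>(1 - s)\<close>, and the reflection formula
finishes the evaluation.
\<close>

lemma rGamma_hankel_left_half_plane:
  assumes \<Phi>: "hankel_primitive s \<Phi>" and s: "Re s < 1"
  shows "((\<lambda>x. \<Phi> (of_real x + \<i> * of_real pi) - \<Phi> (of_real x + \<i> * of_real (- pi)))
    \<longlongrightarrow> 2 * of_real pi * \<i> * rGamma s) at_top"
proof -
  define D where "D = (\<lambda>x. \<Phi> (of_real x + \<i> * of_real pi) - \<Phi> (of_real x + \<i> * of_real (- pi)))"
  define E where "E = (\<lambda>t. if t \<le> 0 then 0 else D (ln t))"
  define S where "S = 2 * \<i> * sin (of_real pi * s)"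
  define f where "f = (\<lambda>t. S * (of_real t powr ((1 - s) - 1) / of_real (exp t)))"
  \<comment> \<open>The two edges of the cut carry the phases \<open>exp (\<plusminus>i \<pi> (1 - s))\<close>.\<close>
  have jump: "exp (\<i> * of_real pi * (1 - s)) - exp (- (\<i> * of_real pi * (1 - s))) = S"
  proof -
    have "exp (\<i> * of_real pi * (1 - s)) - exp (- (\<i> * of_real pi * (1 - s)))
        = 2 * \<i> * sin (of_real pi * (1 - s))"
      by (simp add: sin_exp_eq mult_ac)
    also have "sin (of_real pi * (1 - s)) = sin (of_real pi * s)"
      by (simp add: right_diff_distrib sin_diff sin_of_real cos_of_real)
    finally show ?thesis by (simp add: S_def)
  qed
  have E_deriv: "(E has_vector_derivative f t) (at t)" if t: "t > 0" for t
  proof -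
    have w: "((\<lambda>t. of_real (ln t) + \<i> * of_real a :: complex) has_vector_derivative of_real (1 / t)) (at t)" for a
      using t by (auto intro!: derivative_eq_intros simp: has_real_derivative_iff_has_vector_derivative[symmetric])
    have "((\<lambda>t. D (ln t)) has_vector_derivative
        (of_real (1 / t) * hankel_integrand s (of_real (ln t) + \<i> * of_real pi)
         - of_real (1 / t) * hankel_integrand s (of_real (ln t) + \<i> * of_real (- pi)))) (at t)"
      unfolding D_def by (intro has_vector_derivative_diff hankel_primitive_has_vector_derivative[OF \<Phi> w])
    moreover have "of_real (1 / t) * hankel_integrand s (of_real (ln t) + \<i> * of_real pi)
         - of_real (1 / t) * hankel_integrand s (of_real (ln t) + \<i> * of_real (- pi)) = f t"
    proof -
      have e: "exp (of_real (ln t) + \<i> * of_real pi) = - of_real t"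
          "exp (of_real (ln t) + \<i> * of_real (- pi)) = - of_real t"
        using t by (simp_all add: exp_add exp_diff exp_of_real)
      have p: "of_real t powr ((1 - s) - 1) = exp ((1 - s) * of_real (ln t)) / of_real t"
        using t by (simp add: powr_def Ln_of_real left_diff_distrib exp_diff exp_minus exp_of_real field_simps)
      have "of_real (1 / t) * hankel_integrand s (of_real (ln t) + \<i> * of_real pi)
         - of_real (1 / t) * hankel_integrand s (of_real (ln t) + \<i> * of_real (- pi))
         = of_real (1 / t) * exp (- of_real t) * exp ((1 - s) * of_real (ln t)) *
           (exp (\<i> * of_real pi * (1 - s)) - exp (- (\<i> * of_real pi * (1 - s))))"
      proof -
        have split: "hankel_integrand s (of_real (ln t) + \<i> * of_real a) =
            exp (- of_real t) * exp ((1 - s) * of_real (ln t)) * exp (\<i> * of_real a * (1 - s))"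
          if "exp (of_real (ln t) + \<i> * of_real a) = (- of_real t :: complex)" for a
          unfolding hankel_integrand_def that exp_add[symmetric] by (simp add: algebra_simps)
        show ?thesis
          unfolding split[OF e(1)] split[OF e(2)] by (simp add: right_diff_distrib left_diff_distrib mult.assoc)
      qed
      also have "\<dots> = f t"
        unfolding jump f_def p by (simp add: exp_minus exp_of_real field_simps)
      finally show ?thesis .
    qed
    ultimately have "((\<lambda>t. D (ln t)) has_vector_derivative f t) (at t)"
      by simp
    then show ?thesis
      by (rule has_vector_derivative_transform_within_open[of _ _ _ "{0<..}"]) (use t in \<open>auto simp: E_def\<close>)
  qed
  \<comment> \<open>On the circle of radius \<open>t\<close> the integrand is \<open>O(t\<^bsup>1 - Re s\<^esup>)\<close>; this is where \<open>Re s < 1\<close> enters.\<close>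
  have D_small: "norm (E t) \<le> exp (t + \<bar>Im s\<bar> * pi) * t powr (1 - Re s) * (2 * pi)" if t: "t > 0" for t
  proof -
    have "norm (hankel_integrand s (of_real (ln t) + \<i> * of_real a)) \<le> exp (t + \<bar>Im s\<bar> * pi) * t powr (1 - Re s)"
      if "a \<in> closed_segment (- pi) pi" for a
    proof -
      have "\<bar>a\<bar> \<le> pi"
        using that by (auto simp: closed_segment_eq_real_ivl split: if_splits)
      then have "Im s * a \<le> \<bar>Im s\<bar> * pi"
        using abs_ge_self[of "Im s * a"] mult_left_mono[of "\<bar>a\<bar>" pi "\<bar>Im s\<bar>"] by (simp add: abs_mult)
      moreover have "t * cos a \<le> t"
        using t by simp
      ultimately have "t * cos a + (1 - Re s) * ln t + Im s * a \<le> (t + \<bar>Im s\<bar> * pi) + (1 - Re s) * ln t"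
        by linarith
      then show ?thesis
        unfolding norm_hankel_integrand powr_def using t by (simp flip: exp_add)
    qed
    then show ?thesis
      using hankel_primitive_diff_vertical[OF \<Phi>, of "- pi" pi "ln t" 0 "exp (t + \<bar>Im s\<bar> * pi) * t powr (1 - Re s)"] t
      by (simp add: E_def D_def)
  qed
  have E_cont: "continuous_on {0..} E"
  proof (unfold continuous_on_def, rule ballI)
    fix t :: real assume "t \<in> {0..}"
    show "(E \<longlongrightarrow> E t) (at t within {0..})"
    proof (cases "t = 0")
      case True
      have "((\<lambda>t. t powr (1 - Re s)) \<longlongrightarrow> 0 powr (1 - Re s)) (at 0 within {0..})"
      proof (rule tendsto_powr')
        have "eventually ((\<le>) 0) (at (0::real) within {0..})"
          unfolding eventually_at_filter by (rule always_eventually) auto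
        then show "(0::real) \<noteq> 0 \<or> 0 < 1 - Re s \<and> eventually ((\<le>) 0) (at (0::real) within {0..})"
          using s by simp
      qed auto
      moreover have "((\<lambda>t. exp (t + \<bar>Im s\<bar> * pi)) \<longlongrightarrow> exp (0 + \<bar>Im s\<bar> * pi)) (at 0 within {0..})"
        by (intro tendsto_intros)
      ultimately have "((\<lambda>t. exp (t + \<bar>Im s\<bar> * pi) * t powr (1 - Re s) * (2 * pi)) \<longlongrightarrow>
          exp (0 + \<bar>Im s\<bar> * pi) * 0 powr (1 - Re s) * (2 * pi)) (at 0 within {0..})"
        by (intro tendsto_mult tendsto_const)
      then have "((\<lambda>t. exp (t + \<bar>Im s\<bar> * pi) * t powr (1 - Re s) * (2 * pi)) \<longlongrightarrow> 0) (at 0 within {0..})"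
        by simp
      moreover have "eventually (\<lambda>t. norm (E t) \<le> exp (t + \<bar>Im s\<bar> * pi) * t powr (1 - Re s) * (2 * pi))
          (at 0 within {0..})"
        unfolding eventually_at_filter by (rule always_eventually) (use D_small in auto)
      ultimately have "(E \<longlongrightarrow> 0) (at 0 within {0..})"
        by (rule Lim_null_comparison[rotated])
      then show ?thesis
        using True by (simp add: E_def)
    next
      case False
      then have "isCont E t"
        using E_deriv[of t] \<open>t \<in> {0..}\<close> by (auto intro: has_vector_derivative_continuous)
      then show ?thesis
        using at_le[of "{0..}" UNIV t] by (auto simp: isCont_def intro: tendsto_mono)
    qed
  qed
  have h: "(\<lambda>t. norm S * (t powr ((1 - Re s) - 1) / exp t)) integrable_on {0..}"
    using Gamma_integral_real[of "1 - Re s"] s by (intro integrable_on_mult_right) (auto simp: integrable_on_def)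
  have "norm (f t) \<le> norm S * (t powr ((1 - Re s) - 1) / exp t)" if "t \<ge> 0" for t
    using that by (simp add: f_def norm_mult norm_divide norm_powr_real_powr)
  from dominated_FTC_at_top(2)[OF E_cont E_deriv h this]
  have "(E \<longlongrightarrow> integral {0..} f) at_top"
    by (simp add: E_def)
  moreover have "integral {0..} f = S * Gamma (1 - s)"
    unfolding f_def by (intro integral_unique has_integral_mult_right Gamma_integral_complex) (use s in simp)
  moreover have "S * Gamma (1 - s) = 2 * of_real pi * \<i> * rGamma s"
  proof -
    have "rGamma (1 - s) * Gamma (1 - s) = 1"
    proof -
      have "1 - s \<notin> \<int>\<^sub>\<le>\<^sub>0"
        using s by (auto elim!: nonpos_Ints_cases simp: complex_eq_iff)
      then show ?thesis
        by (simp add: Gamma_def rGamma_eq_zero_iff)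
    qed
    moreover have "S = 2 * of_real pi * \<i> * (rGamma s * rGamma (1 - s))"
      by (simp add: S_def rGamma_reflection_complex)
    ultimately show ?thesis
      by (simp add: mult.assoc)
  qed
  ultimately have "(E \<longlongrightarrow> 2 * of_real pi * \<i> * rGamma s) at_top"
    by simp
  from filterlim_compose[OF this exp_at_top]
  show ?thesis
    by (simp add: E_def D_def)
qed

text \<open>
The recurrence below cannot reach \<open>s = 1\<close> from \<open>s = 0\<close>. Here the integrand has period \<open>2 \<pi> i\<close>, so the difference is
constant in \<open>x\<close>, and as \<open>x \<rightarrow> -\<infinity>\<close> the integrand \<open>exp (e\<^sup>w)\<close> tends to \<open>1\<close>: this is the residue of \<open>e\<^sup>t / t\<close>
at \<open>0\<close>.
\<close>

lemma rGamma_hankel_one: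
  assumes \<Phi>: "hankel_primitive 1 \<Phi>"
  shows "((\<lambda>x. \<Phi> (of_real x + \<i> * of_real pi) - \<Phi> (of_real x + \<i> * of_real (- pi)))
    \<longlongrightarrow> 2 * of_real pi * \<i> * rGamma 1) at_top"
proof -
  define D where "D = (\<lambda>x. \<Phi> (of_real x + \<i> * of_real pi) - \<Phi> (of_real x + \<i> * of_real (- pi)))"
  have deriv: "(D has_vector_derivative 0) (at x)" for x
  proof -
    have w: "((\<lambda>x. of_real x + \<i> * of_real a :: complex) has_vector_derivative 1) (at x)" for a
      by (auto intro!: derivative_eq_intros)
    have "(D has_vector_derivative
        (1 * hankel_integrand 1 (of_real x + \<i> * of_real pi)
         - 1 * hankel_integrand 1 (of_real x + \<i> * of_real (- pi)))) (at x)"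
      unfolding D_def by (intro has_vector_derivative_diff hankel_primitive_has_vector_derivative[OF \<Phi> w])
    then show ?thesis
      by (simp add: hankel_integrand_def exp_add exp_diff)
  qed
  have const: "D x = D y" for x y
    using has_vector_derivative_zero_constant[of UNIV D] deriv by (metis UNIV_I convex_UNIV)
  have bound: "norm (D x - 2 * of_real pi * \<i>) \<le> exp x * exp (exp x) * (2 * pi)" for x
  proof -
    have "norm (hankel_integrand 1 (of_real x + \<i> * of_real a) - 1) \<le> exp x * exp (exp x)" for a
    proof -
      let ?u = "exp (of_real x + \<i> * of_real a) :: complex"
      have "norm (exp ?u - exp 0) \<le> exp (norm ?u) * norm (?u - 0)"
      proof (rule field_differentiable_bound)
        fix v assume v: "v \<in> closed_segment 0 ?u"
        show "(exp has_field_derivative exp v) (at v within closed_segment 0 ?u)"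
          by (auto intro: derivative_eq_intros)
        have "norm v \<le> norm ?u"
          using segment_bound(1)[OF v] by simp
        then show "norm (exp v) \<le> exp (norm ?u)"
          using norm_exp[of v] by (meson exp_le_cancel_iff order_trans)
      qed auto
      then show ?thesis
        by (simp add: hankel_integrand_def mult.commute)
    qed
    then have "norm ((\<Phi> (of_real x + \<i> * of_real pi) - \<Phi> (of_real x + \<i> * of_real (- pi)))
        - 1 * (\<i> * of_real (pi - - pi))) \<le> exp x * exp (exp x) * \<bar>pi - - pi\<bar>"
      by (intro hankel_primitive_diff_vertical[OF \<Phi>])
    moreover have "1 * (\<i> * of_real (pi - - pi)) = 2 * of_real pi * \<i>" "\<bar>pi - - pi\<bar> = 2 * pi"
      by auto
    ultimately show ?thesis
      unfolding D_def by metis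
  qed
  have "((\<lambda>x. exp x * exp (exp x) * (2 * pi)) \<longlongrightarrow> 0 * exp 0 * (2 * pi)) at_bot"
    by (intro tendsto_intros exp_at_bot)
  then have "((\<lambda>x. D x - 2 * of_real pi * \<i>) \<longlongrightarrow> 0) at_bot"
    by (intro Lim_null_comparison[OF always_eventually[OF allI[OF bound]]]) simp
  moreover obtain d where d: "D x = d" for x
    using const by blast
  ultimately have "((\<lambda>x::real. d - 2 * of_real pi * \<i>) \<longlongrightarrow> 0) at_bot"
    by simp
  then have "d = 2 * of_real pi * \<i>"
    by (simp add: tendsto_const_iff)
  then show ?thesis
    using d unfolding D_def by simp
qed

text \<open>
Integration by parts: the derivative of \<open>exp (e\<^sup>w - s w)\<close> is the integrand for \<open>s\<close> minus \<open>s\<close> times the integrand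
for \<open>s + 1\<close>, and the boundary terms vanish. This matches the functional equation
\<open>s / \<Gamma>(s + 1) = 1 / \<Gamma>(s)\<close>.
\<close>

lemma rGamma_hankel_shift:
  assumes s: "s \<noteq> 0"
    and IH: "\<And>\<Psi>. hankel_primitive s \<Psi> \<Longrightarrow>
      ((\<lambda>x. \<Psi> (of_real x + \<i> * of_real pi) - \<Psi> (of_real x + \<i> * of_real (- pi)))
        \<longlongrightarrow> 2 * of_real pi * \<i> * rGamma s) at_top"
    and \<Phi>: "hankel_primitive (s + 1) \<Phi>"
  shows "((\<lambda>x. \<Phi> (of_real x + \<i> * of_real pi) - \<Phi> (of_real x + \<i> * of_real (- pi)))
    \<longlongrightarrow> 2 * of_real pi * \<i> * rGamma (s + 1)) at_top"
proof -
  define \<Psi> where "\<Psi> = (\<lambda>w. s * \<Phi> w + hankel_integrand (s + 1) w)"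
  have \<Psi>: "hankel_primitive s \<Psi>"
    unfolding hankel_primitive_def
  proof
    fix w
    have "(hankel_integrand (s + 1) has_field_derivative hankel_integrand (s + 1) w * (exp w - s)) (at w)"
      unfolding hankel_integrand_def by (auto intro!: derivative_eq_intros)
    moreover have "hankel_integrand (s + 1) w * exp w = hankel_integrand s w"
      by (simp add: hankel_integrand_def algebra_simps flip: exp_add)
    ultimately show "(\<Psi> has_field_derivative hankel_integrand s w) (at w)"
      using \<Phi> unfolding \<Psi>_def hankel_primitive_def
      by (auto intro!: derivative_eq_intros simp: algebra_simps)
  qed
  have zero: "((\<lambda>x. hankel_integrand (s + 1) (of_real x + \<i> * of_real a)) \<longlongrightarrow> 0) at_top"
    if a: "cos a = - 1" for a
  proof -
    obtain C where C: "\<And>x a'. x \<ge> 0 \<Longrightarrow> cos a' \<le> - 1 \<Longrightarrow> \<bar>a'\<bar> \<le> \<bar>a\<bar> \<Longrightarrow>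
      norm (hankel_integrand (s + 1) (of_real x + \<i> * of_real a')) \<le> C * exp (- 1 * x)"
      using hankel_integrand_decay[OF zero_less_one] by blast
    have "((\<lambda>x::real. exp (- x)) \<longlongrightarrow> 0) at_top"
      by (rule filterlim_compose[OF exp_at_bot filterlim_uminus_at_bot_at_top])
    then have "((\<lambda>x. C * exp (- 1 * x)) \<longlongrightarrow> 0) at_top"
      by (auto intro: tendsto_mult_right_zero)
    moreover have "eventually (\<lambda>x. norm (hankel_integrand (s + 1) (of_real x + \<i> * of_real a)) \<le> C * exp (- 1 * x)) at_top"
      using eventually_ge_at_top[of 0] by eventually_elim (rule C; use a in simp)
    ultimately show ?thesis
      by (rule Lim_null_comparison[rotated])
  qed
  have "((\<lambda>x. (\<Psi> (of_real x + \<i> * of_real pi) - \<Psi> (of_real x + \<i> * of_real (- pi))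
      - (hankel_integrand (s + 1) (of_real x + \<i> * of_real pi)
         - hankel_integrand (s + 1) (of_real x + \<i> * of_real (- pi)))) / s)
      \<longlongrightarrow> (2 * of_real pi * \<i> * rGamma s - (0 - 0)) / s) at_top"
    by (intro tendsto_intros IH[OF \<Psi>] zero s) auto
  moreover have "(2 * of_real pi * \<i> * rGamma s - (0 - 0)) / s = 2 * of_real pi * \<i> * rGamma (s + 1)"
    using s by (simp flip: rGamma_plus1[of s])
  moreover have "(\<Psi> v - \<Psi> w - (hankel_integrand (s + 1) v - hankel_integrand (s + 1) w)) / s = \<Phi> v - \<Phi> w" for v w
    using s by (simp add: \<Psi>_def field_simps)
  ultimately show ?thesis
    by simp
qed

lemma rGamma_hankel:
  assumes "hankel_primitive s \<Phi>"
  shows "((\<lambda>x. \<Phi> (of_real x + \<i> * of_real pi) - \<Phi> (of_real x + \<i> * of_real (- pi)))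
    \<longlongrightarrow> 2 * of_real pi * \<i> * rGamma s) at_top"
proof -
  obtain n :: nat where "Re s < 1 + real n"
    using reals_Archimedean2[of "Re s - 1"] by (auto simp: algebra_simps)
  then show ?thesis
    using assms
  proof (induction n arbitrary: s \<Phi>)
    case 0
    then show ?case
      by (intro rGamma_hankel_left_half_plane) auto
  next
    case (Suc n)
    show ?case
    proof (cases "s = 1")
      case True
      then show ?thesis
        using rGamma_hankel_one Suc.prems by blast
    next
      case False
      then have "((\<lambda>x. \<Phi> (of_real x + \<i> * of_real pi) - \<Phi> (of_real x + \<i> * of_real (- pi)))
          \<longlongrightarrow> 2 * of_real pi * \<i> * rGamma ((s - 1) + 1)) at_top"
        using Suc by (intro rGamma_hankel_shift[of "s - 1"]) auto
      then show ?thesis by simp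
    qed
  qed
qed

section \<open>Hankel's formula on a contour of two rays and an arc\<close>

lemma cos_neg_left_half_plane:
  assumes "pi / 2 < \<bar>a\<bar>" "\<bar>a\<bar> < 3 * pi / 2"
  shows "cos a < 0"
proof -
  have "cos \<bar>a\<bar> < 0"
    using cos_gt_zero_pi[of "\<bar>a\<bar> - pi"] assms by (simp add: cos_diff)
  then show ?thesis
    by (simp add: abs_real_def split: if_splits)
qed

lemma rGamma_hankel_angles:
  assumes \<Phi>: "hankel_primitive s \<Phi>"
    and \<alpha>: "pi / 2 < \<alpha>" "\<alpha> < 3 * pi / 2"
    and \<beta>: "- (3 * pi / 2) < \<beta>" "\<beta> < - (pi / 2)"
  shows "((\<lambda>x. \<Phi> (of_real x + \<i> * of_real \<alpha>) - \<Phi> (of_real x + \<i> * of_real \<beta>))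
    \<longlongrightarrow> 2 * of_real pi * \<i> * rGamma s) at_top"
proof -
  have "((\<lambda>x. \<Phi> (of_real x + \<i> * of_real \<alpha>) - \<Phi> (of_real x + \<i> * of_real pi)) \<longlongrightarrow> 0) at_top"
    by (rule hankel_primitive_limit_angle_indep[OF \<Phi>], rule cos_neg_left_half_plane)
      (use \<alpha> pi_gt_zero in \<open>auto simp: closed_segment_eq_real_ivl split: if_splits\<close>)
  moreover have "((\<lambda>x. \<Phi> (of_real x + \<i> * of_real \<beta>) - \<Phi> (of_real x + \<i> * of_real (- pi))) \<longlongrightarrow> 0) at_top"
    by (rule hankel_primitive_limit_angle_indep[OF \<Phi>], rule cos_neg_left_half_plane)
      (use \<beta> pi_gt_zero in \<open>auto simp: closed_segment_eq_real_ivl split: if_splits\<close>)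
  ultimately have "((\<lambda>x. (\<Phi> (of_real x + \<i> * of_real \<alpha>) - \<Phi> (of_real x + \<i> * of_real pi))
      - (\<Phi> (of_real x + \<i> * of_real \<beta>) - \<Phi> (of_real x + \<i> * of_real (- pi)))
      + (\<Phi> (of_real x + \<i> * of_real pi) - \<Phi> (of_real x + \<i> * of_real (- pi))))
      \<longlongrightarrow> 0 - 0 + 2 * of_real pi * \<i> * rGamma s) at_top"
    by (intro tendsto_add tendsto_diff rGamma_hankel[OF \<Phi>])
  then show ?thesis
    by (simp add: algebra_simps)
qed

text \<open>
The factor \<open>\<rho> / r\<close> is the Jacobian of the substitution \<open>w = \<rho> ln (m r) + i \<alpha>\<close>.
\<close>

lemma hankel_ray_bound:
  assumes "\<rho> > 0" "m > 0" "R > 0" "cos \<alpha> < 0"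
  obtains C where "\<And>r. r \<ge> R \<Longrightarrow>
    norm (of_real (\<rho> / r) * hankel_integrand s (of_real (\<rho> * ln (m * r)) + \<i> * of_real \<alpha>)) \<le> C * (1 / r\<^sup>2)"
proof -
  obtain C where C: "\<And>x a. x \<ge> \<rho> * ln (m * R) \<Longrightarrow> cos a \<le> - (- cos \<alpha>) \<Longrightarrow> \<bar>a\<bar> \<le> \<bar>\<alpha>\<bar> \<Longrightarrow>
    norm (hankel_integrand s (of_real x + \<i> * of_real a)) \<le> C * exp (- (1 / \<rho>) * x)"
    using hankel_integrand_decay[of "- cos \<alpha>"] assms by (metis neg_0_less_iff_less)
  show ?thesis
  proof
    fix r assume r: "r \<ge> R"
    have "norm (of_real (\<rho> / r) * hankel_integrand s (of_real (\<rho> * ln (m * r)) + \<i> * of_real \<alpha>))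
        = \<rho> / r * norm (hankel_integrand s (of_real (\<rho> * ln (m * r)) + \<i> * of_real \<alpha>))"
      using assms r by (simp add: norm_mult norm_divide)
    also have "\<dots> \<le> \<rho> / r * (C * exp (- (1 / \<rho>) * (\<rho> * ln (m * r))))"
      using assms r by (intro mult_left_mono C) auto
    also have "exp (- (1 / \<rho>) * (\<rho> * ln (m * r))) = 1 / (m * r)"
      using assms r by (simp add: exp_minus inverse_eq_divide)
    also have "\<rho> / r * (C * (1 / (m * r))) = \<rho> * C / m * (1 / r\<^sup>2)"
      by (simp add: power2_eq_square)
    finally show "norm (of_real (\<rho> / r) * hankel_integrand s (of_real (\<rho> * ln (m * r)) + \<i> * of_real \<alpha>))
        \<le> \<rho> * C / m * (1 / r\<^sup>2)" .
  qed
qed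

lemma inverse_square_integrable: "R > 0 \<Longrightarrow> (\<lambda>r::real. C * (1 / r\<^sup>2)) integrable_on {R..}"
  by (rule integrable_on_mult_right[OF has_integral_integrable[OF has_integral_inverse_power_to_inf]]) auto

lemma hankel_ray_integral:
  fixes \<rho> m R \<alpha> :: real
  assumes \<Phi>: "hankel_primitive s \<Phi>" and pos: "\<rho> > 0" "m > 0" "R > 0" and neg: "cos \<alpha> < 0"
  defines "w \<equiv> (\<lambda>r. of_real (\<rho> * ln (m * r)) + \<i> * of_real \<alpha> :: complex)"
  shows "(\<lambda>r. of_real (\<rho> / r) * hankel_integrand s (w r)) integrable_on {R..}"
    and "((\<lambda>r. \<Phi> (w r)) \<longlongrightarrow>
      \<Phi> (w R) + integral {R..} (\<lambda>r. of_real (\<rho> / r) * hankel_integrand s (w r))) at_top"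
proof -
  obtain C where C: "\<And>r. r \<ge> R \<Longrightarrow>
    norm (of_real (\<rho> / r) * hankel_integrand s (w r)) \<le> C * (1 / r\<^sup>2)"
    using hankel_ray_bound[OF pos neg] unfolding w_def by blast
  have deriv: "((\<lambda>r. \<Phi> (w r)) has_vector_derivative of_real (\<rho> / r) * hankel_integrand s (w r)) (at r)"
    if r: "r > 0" for r
  proof (rule hankel_primitive_has_vector_derivative[OF \<Phi>])
    have "((\<lambda>r. \<rho> * ln (m * r)) has_real_derivative \<rho> / r) (at r)"
      using pos r by (auto intro!: derivative_eq_intros)
    then show "(w has_vector_derivative of_real (\<rho> / r)) (at r)"
      unfolding w_def by (intro has_vector_derivative_add_const[THEN iffD2] has_vector_derivative_of_real)
  qed
  have cont: "continuous_on {R..} (\<lambda>r. \<Phi> (w r))"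
    by (intro continuous_at_imp_continuous_on ballI has_vector_derivative_continuous[OF deriv]) (use pos in auto)
  have d: "((\<lambda>r. \<Phi> (w r)) has_vector_derivative of_real (\<rho> / r) * hankel_integrand s (w r)) (at r)"
    if "r > R" for r
    using deriv that pos by simp
  show "(\<lambda>r. of_real (\<rho> / r) * hankel_integrand s (w r)) integrable_on {R..}"
    and "((\<lambda>r. \<Phi> (w r)) \<longlongrightarrow>
      \<Phi> (w R) + integral {R..} (\<lambda>r. of_real (\<rho> / r) * hankel_integrand s (w r))) at_top"
    using dominated_FTC_at_top[OF cont d inverse_square_integrable[OF \<open>R > 0\<close>] C] by blast+
qed

lemma hankel_arc_integral:
  fixes \<phi>1 \<phi>2 \<rho> \<theta> x :: real
  assumes \<Phi>: "hankel_primitive s \<Phi>" and le: "\<phi>1 \<le> \<phi>2"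
  defines "w \<equiv> (\<lambda>\<phi>. of_real x + \<i> * of_real (\<rho> * (\<theta> + \<phi>)) :: complex)"
  shows "((\<lambda>\<phi>. \<i> * of_real \<rho> * hankel_integrand s (w \<phi>)) has_integral (\<Phi> (w \<phi>2) - \<Phi> (w \<phi>1))) {\<phi>1..\<phi>2}"
proof (rule fundamental_theorem_of_calculus[OF le])
  fix \<phi>
  have "(w has_vector_derivative \<i> * of_real \<rho>) (at \<phi>)"
  proof -
    have "((\<lambda>\<phi>. \<rho> * (\<theta> + \<phi>)) has_real_derivative \<rho>) (at \<phi>)"
      by (auto intro!: derivative_eq_intros)
    from has_vector_derivative_mult_right[OF has_vector_derivative_of_real[OF this], of \<i>]
    have "((\<lambda>\<phi>. of_real x + \<i> * of_real (\<rho> * (\<theta> + \<phi>))) has_vector_derivative 0 + \<i> * of_real \<rho>) (at \<phi>)"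
      by (intro has_vector_derivative_add has_vector_derivative_const)
    then show ?thesis
      unfolding w_def by simp
  qed
  then show "((\<lambda>\<phi>. \<Phi> (w \<phi>)) has_vector_derivative \<i> * of_real \<rho> * hankel_integrand s (w \<phi>)) (at \<phi> within {\<phi>1..\<phi>2})"
    by (rule has_vector_derivative_at_within[OF hankel_primitive_has_vector_derivative[OF \<Phi>]])
qed

text \<open>
Hankel's formula in the parameters \<open>r\<close> and \<open>\<phi>\<close> of the variable \<open>\<zeta> = m r e\<^bsup>i(\<theta> + \<phi>)\<^esup>\<close>, where \<open>w = \<rho> ln \<zeta>\<close>. The values
of the primitive at the two corners of the contour cancel, leaving the difference of its limits at infinity.
\<close>

lemma rGamma_hankel_contour:
  fixes \<rho> m R \<theta> \<phi>1 \<phi>2 :: real and s :: complex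
  assumes pos: "\<rho> > 0" "m > 0" "R > 0" and le: "\<phi>1 \<le> \<phi>2"
    and up: "pi / 2 < \<rho> * (\<theta> + \<phi>2)" "\<rho> * (\<theta> + \<phi>2) < 3 * pi / 2"
    and lo: "- (3 * pi / 2) < \<rho> * (\<theta> + \<phi>1)" "\<rho> * (\<theta> + \<phi>1) < - (pi / 2)"
  defines "w \<equiv> (\<lambda>r \<phi>. of_real (\<rho> * ln (m * r)) + \<i> * of_real (\<rho> * (\<theta> + \<phi>)) :: complex)"
  obtains I1 I2 J where
    "((\<lambda>r. of_real (\<rho> / r) * hankel_integrand s (w r \<phi>1)) has_integral I1) {R..}"
    "((\<lambda>r. of_real (\<rho> / r) * hankel_integrand s (w r \<phi>2)) has_integral I2) {R..}"
    "((\<lambda>\<phi>. \<i> * of_real \<rho> * hankel_integrand s (w R \<phi>)) has_integral J) {\<phi>1..\<phi>2}"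
    "I2 - I1 + J = 2 * of_real pi * \<i> * rGamma s"
proof -
  obtain \<Phi> where \<Phi>: "hankel_primitive s \<Phi>"
    by (rule hankel_primitive_exists)
  have neg: "cos (\<rho> * (\<theta> + \<phi>1)) < 0" "cos (\<rho> * (\<theta> + \<phi>2)) < 0"
    by (rule cos_neg_left_half_plane; use up lo in simp)+
  note ray1 = hankel_ray_integral[OF \<Phi> pos neg(1)] and ray2 = hankel_ray_integral[OF \<Phi> pos neg(2)]
  let ?I = "\<lambda>\<phi>. integral {R..} (\<lambda>r. of_real (\<rho> / r) * hankel_integrand s (w r \<phi>))"
  have lim: "((\<lambda>r. \<Phi> (w r \<phi>2) - \<Phi> (w r \<phi>1)) \<longlongrightarrow>
      (\<Phi> (w R \<phi>2) + ?I \<phi>2) - (\<Phi> (w R \<phi>1) + ?I \<phi>1)) at_top"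
    unfolding w_def by (intro tendsto_diff ray1(2) ray2(2))
  have "filterlim (\<lambda>r. \<rho> * ln (m * r)) at_top at_top"
    by (intro filterlim_tendsto_pos_mult_at_top[OF tendsto_const] filterlim_compose[OF ln_at_top]
        filterlim_ident pos)
  from filterlim_compose[OF rGamma_hankel_angles[OF \<Phi> up lo] this]
  have "((\<lambda>r. \<Phi> (w r \<phi>2) - \<Phi> (w r \<phi>1)) \<longlongrightarrow> 2 * of_real pi * \<i> * rGamma s) at_top"
    unfolding w_def .
  from tendsto_unique[OF _ lim this]
  have eq: "?I \<phi>2 - ?I \<phi>1 + (\<Phi> (w R \<phi>2) - \<Phi> (w R \<phi>1)) = 2 * of_real pi * \<i> * rGamma s"
    by (simp add: algebra_simps)
  show ?thesis
  proof (rule that[OF integrable_integral integrable_integral _ eq])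
    show "(\<lambda>r. of_real (\<rho> / r) * hankel_integrand s (w r \<phi>1)) integrable_on {R..}"
      unfolding w_def by (rule ray1(1))
    show "(\<lambda>r. of_real (\<rho> / r) * hankel_integrand s (w r \<phi>2)) integrable_on {R..}"
      unfolding w_def by (rule ray2(1))
    show "((\<lambda>\<phi>. \<i> * of_real \<rho> * hankel_integrand s (w R \<phi>)) has_integral
        (\<Phi> (w R \<phi>2) - \<Phi> (w R \<phi>1))) {\<phi>1..\<phi>2}"
      unfolding w_def by (rule hankel_arc_integral[OF \<Phi> le])
  qed
qed

section \<open>Identification of the kernels\<close>

text \<open>
With \<open>z = exp l\<close> and \<open>\<zeta> = exp (l + u)\<close>, the factor \<open>exp (- u)\<close> is \<open>z / \<zeta>\<close>: the \<open>k\<close>-th term of the expanded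
Cauchy kernel shifts the parameter of the integrand by \<open>k / \<rho>\<close>.
\<close>

lemma hankel_integrand_times_power:
  assumes "\<rho> \<noteq> 0"
  shows "hankel_integrand \<mu> (of_real \<rho> * (l + u)) * exp (- u) ^ k =
    exp l ^ k * hankel_integrand (\<mu> + of_real (real k / \<rho>)) (of_real \<rho> * (l + u))"
proof -
  let ?w = "of_real \<rho> * (l + u)" and ?s = "\<mu> + of_real (real k / \<rho>)"
  have "of_real (real k / \<rho>) * ?w = of_nat k * (l + u)"
    using assms by simp
  then have "(1 - ?s) * ?w = (1 - \<mu>) * ?w - of_nat k * (l + u)"
    by (simp only: diff_diff_eq[symmetric] left_diff_distrib)
  then have "(1 - \<mu>) * ?w + of_nat k * (- u) = of_nat k * l + (1 - ?s) * ?w"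
    by (simp only: distrib_left) simp
  then have "exp (exp ?w + ((1 - \<mu>) * ?w + of_nat k * (- u))) =
      exp (of_nat k * l + (exp ?w + (1 - ?s) * ?w))"
    by (simp only: add.left_commute)
  then show ?thesis
    by (simp only: hankel_integrand_def exp_of_nat_mult exp_add mult.assoc)
qed

text \<open>
The denominator is \<open>|r - e\<^sup>i\<^sup>\<phi>|\<^sup>2\<close>. The left-hand side of the equation occurs in the definitions of \<open>K\<close> and \<open>P\<close>;
the right-hand side is the form that expands into a geometric series.
\<close>

lemma cauchy_kernel_polar:
  assumes "r > 1"
  shows "r\<^sup>2 - 2 * r * cos \<phi> + 1 > 0"
    and "(of_real r - exp (\<i> * of_real \<phi>)) / of_real (r\<^sup>2 - 2 * r * cos \<phi> + 1) =
      of_real (1 / r) / (1 - exp (- (\<i> * of_real \<phi>)) / of_real r)"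
proof -
  have "r * cos \<phi> \<le> r"
    using assms by simp
  moreover have "(r - 1)\<^sup>2 > 0"
    using assms by simp
  ultimately show pos: "r\<^sup>2 - 2 * r * cos \<phi> + 1 > 0"
    by (simp add: power2_diff)
  let ?e = "exp (\<i> * of_real \<phi>) :: complex" and ?e' = "exp (- (\<i> * of_real \<phi>)) :: complex"
  have prod: "(of_real r - ?e) * (of_real r - ?e') = of_real (r\<^sup>2 - 2 * r * cos \<phi> + 1)"
  proof -
    have "?e * ?e' = 1"
      by (simp flip: exp_add)
    moreover have "?e + ?e' = 2 * of_real (cos \<phi>)"
      by (simp add: cos_exp_eq flip: cos_of_real)
    moreover have "(of_real r - ?e) * (of_real r - ?e') = of_real r ^ 2 - of_real r * (?e + ?e') + ?e * ?e'"
      by (simp add: algebra_simps power2_eq_square)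
    ultimately show ?thesis
      by simp
  qed
  moreover have "complex_of_real (r\<^sup>2 - 2 * r * cos \<phi> + 1) \<noteq> 0"
    using pos by (metis less_irrefl of_real_eq_0_iff)
  ultimately have nz: "of_real r - ?e \<noteq> 0" "of_real r - ?e' \<noteq> 0"
    by auto
  have "of_real (1 / r) / (1 - ?e' / of_real r) = 1 / (of_real r - ?e')"
    using assms by (simp add: field_simps)
  also have "\<dots> = (of_real r - ?e) / ((of_real r - ?e) * (of_real r - ?e'))"
    using nz by simp
  finally show "(of_real r - ?e) / of_real (r\<^sup>2 - 2 * r * cos \<phi> + 1) =
      of_real (1 / r) / (1 - ?e' / of_real r)"
    unfolding prod by simp
qed

lemma exp_i_of_real: "exp (\<i> * of_real x) = of_real (cos x) + \<i> * of_real (sin x)"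
  by (simp add: exp_Euler cos_of_real sin_of_real)

lemma P_ml_eq_hankel:
  assumes "r > 1"
  shows "P_ml \<rho> \<mu> r \<phi> z = 1 / (2 * of_real pi * \<i>) *
    (\<i> * of_real \<rho> * hankel_integrand \<mu> (of_real (\<rho> * ln (cmod z * r)) + \<i> * of_real (\<rho> * (Arg2pi z + \<phi>)))
      / (1 - exp (- (\<i> * of_real \<phi>)) / of_real r))"
proof -
  let ?w = "of_real (\<rho> * ln (cmod z * r)) + \<i> * of_real (\<rho> * (Arg2pi z + \<phi>)) :: complex"
  let ?T = "pow_arg2pi z r (of_real \<rho>)"
  have "exp ?w = ?T * exp (\<i> * of_real (\<rho> * \<phi>))"
    by (simp add: pow_arg2pi_def algebra_simps flip: exp_add)
  also have "\<dots> = ?T * of_real (cos (\<rho> * \<phi>)) + \<i> * (?T * of_real (sin (\<rho> * \<phi>)))"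
    unfolding exp_i_of_real by (simp only: distrib_left mult.left_commute)
  finally have w: "exp ?w = ?T * of_real (cos (\<rho> * \<phi>)) + \<i> * (?T * of_real (sin (\<rho> * \<phi>)))" .
  have g: "exp (?T * of_real (cos (\<rho> * \<phi>))) * pow_arg2pi z r (of_real \<rho> * (1 - \<mu>))
      * exp (\<i> * chi_ml \<rho> \<mu> r \<phi> z) = hankel_integrand \<mu> ?w"
    unfolding hankel_integrand_def w chi_ml_def pow_arg2pi_def[of z r "of_real \<rho> * (1 - \<mu>)"]
    by (simp add: algebra_simps flip: exp_add)
  have "P_ml \<rho> \<mu> r \<phi> z = of_real (\<rho> / (2 * pi)) * (hankel_integrand \<mu> ?w * of_real r *
      ((of_real r - exp (\<i> * of_real \<phi>)) / of_real (r\<^sup>2 - 2 * r * cos \<phi> + 1)))"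
    unfolding P_ml_def g by simp
  also have "\<dots> = 1 / (2 * of_real pi * \<i>) * (\<i> * of_real \<rho> * hankel_integrand \<mu> ?w
      / (1 - exp (- (\<i> * of_real \<phi>)) / of_real r))"
    unfolding cauchy_kernel_polar(2)[OF assms] using assms by simp
  finally show ?thesis .
qed

text \<open>
The angle \<open>\<omega>\<close> of \<open>K\<close> is measured from the ray opposite to \<open>z\<close>, whence the shift \<open>\<phi> = \<omega> - \<pi>\<close> and the changed signs in
the denominators.
\<close>

lemma K_ml_eq_hankel:
  fixes \<rho> r \<omega>1 \<omega>2 :: real and \<mu> z :: complex
  assumes r: "r > 1"
  defines "k \<equiv> (\<lambda>\<phi>. of_real (\<rho> / r) *
    hankel_integrand \<mu> (of_real (\<rho> * ln (cmod z * r)) + \<i> * of_real (\<rho> * (Arg2pi z + \<phi>)))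
      / (1 - exp (- (\<i> * of_real \<phi>)) / of_real r))"
  shows "K_ml \<rho> \<mu> r \<omega>1 \<omega>2 z = 1 / (2 * of_real pi * \<i>) * (k (\<omega>2 - pi) - k (\<omega>1 - pi))"
proof -
  define d where "d = (\<lambda>\<omega>. complex_of_real (r\<^sup>2 + 2 * r * cos \<omega> + 1))"
  define c where "c = pow_arg2pi z r (of_real \<rho> * (1 - \<mu>)) * exp (- \<i> * of_real \<rho> * of_real pi * (1 - \<mu>))"
  define w where "w = (\<lambda>\<omega>. of_real (\<rho> * ln (cmod z * r)) + \<i> * of_real (\<rho> * (Arg2pi z + (\<omega> - pi))) :: complex)"
  have k: "of_real \<rho> * hankel_integrand \<mu> (w \<omega>) * (of_real r + exp (\<i> * of_real \<omega>)) / d \<omega> = k (\<omega> - pi)"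
    and d: "d \<omega> \<noteq> 0" for \<omega>
  proof -
    have e: "exp (\<i> * of_real (\<omega> - pi)) = - exp (\<i> * of_real \<omega>)"
      by (simp add: right_diff_distrib exp_diff)
    have c: "r\<^sup>2 - 2 * r * cos (\<omega> - pi) + 1 = r\<^sup>2 + 2 * r * cos \<omega> + 1"
      by (simp add: cos_diff)
    note kernel = cauchy_kernel_polar[OF r, of "\<omega> - pi", unfolded e c]
    show "d \<omega> \<noteq> 0"
      unfolding d_def using kernel(1) by (metis less_irrefl of_real_eq_0_iff)
    have "of_real \<rho> * hankel_integrand \<mu> (w \<omega>) * ((of_real r - - exp (\<i> * of_real \<omega>)) / d \<omega>) = k (\<omega> - pi)"
      unfolding d_def kernel(2) by (simp add: k_def w_def)
    then show "of_real \<rho> * hankel_integrand \<mu> (w \<omega>) * (of_real r + exp (\<i> * of_real \<omega>)) / d \<omega> = k (\<omega> - pi)"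
      by simp
  qed
  have A: "c * A_ml \<rho> \<mu> r \<omega> \<omega>' z = hankel_integrand \<mu> (w \<omega>) * (of_real r + exp (\<i> * of_real \<omega>)) * d \<omega>'" for \<omega> \<omega>'
  proof -
    let ?T = "pow_arg2pi z r (of_real \<rho>) * exp (- \<i> * of_real (\<rho> * pi))"
    have "exp (w \<omega>) = ?T * exp (\<i> * of_real (\<rho> * \<omega>))"
      by (simp add: pow_arg2pi_def w_def algebra_simps flip: exp_add)
    also have "\<dots> = ?T * of_real (cos (\<rho> * \<omega>)) + \<i> * (?T * of_real (sin (\<rho> * \<omega>)))"
      unfolding exp_i_of_real by (simp only: distrib_left mult.left_commute)
    finally have w: "exp (w \<omega>) = ?T * of_real (cos (\<rho> * \<omega>)) + \<i> * (?T * of_real (sin (\<rho> * \<omega>)))" .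
    have "c * exp (?T * of_real (cos (\<rho> * \<omega>))) * exp (\<i> * eta_ml \<rho> \<mu> r \<omega> z) = hankel_integrand \<mu> (w \<omega>)"
      unfolding hankel_integrand_def w eta_ml_def c_def pow_arg2pi_def[of z r "of_real \<rho> * (1 - \<mu>)"]
      by (simp add: w_def algebra_simps flip: exp_add)
    moreover have "c * A_ml \<rho> \<mu> r \<omega> \<omega>' z = c * exp (?T * of_real (cos (\<rho> * \<omega>))) * exp (\<i> * eta_ml \<rho> \<mu> r \<omega> z)
        * (of_real r + exp (\<i> * of_real \<omega>)) * d \<omega>'"
      unfolding A_ml_def d_def by (simp only: mult_ac)
    ultimately show ?thesis
      by simp
  qed
  have "K_ml \<rho> \<mu> r \<omega>1 \<omega>2 z =
      of_real \<rho> / (2 * of_real pi * \<i>) * (c * A_ml \<rho> \<mu> r \<omega>2 \<omega>1 z - c * A_ml \<rho> \<mu> r \<omega>1 \<omega>2 z) / (d \<omega>1 * d \<omega>2)"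
    by (simp add: K_ml_def c_def d_def right_diff_distrib)
  also have "\<dots> = 1 / (2 * of_real pi * \<i>) *
      (of_real \<rho> * hankel_integrand \<mu> (w \<omega>2) * (of_real r + exp (\<i> * of_real \<omega>2)) / d \<omega>2
       - of_real \<rho> * hankel_integrand \<mu> (w \<omega>1) * (of_real r + exp (\<i> * of_real \<omega>1)) / d \<omega>1)"
    unfolding A using d[of \<omega>1] d[of \<omega>2] by (simp add: divide_simps) (simp add: algebra_simps)
  finally show ?thesis
    unfolding k .
qed

section \<open>The integral representation\<close>

theorem theorem2:
  fixes \<rho> \<epsilon> \<delta>1 \<delta>2 :: real and \<mu> z :: complex
  assumes "\<rho> > 1 / 2"
    and "\<epsilon> > 0"
    and "pi / (2 * \<rho>) < \<delta>1" and "\<delta>1 \<le> min pi (pi / \<rho>)"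
    and "pi / (2 * \<rho>) < \<delta>2" and "\<delta>2 \<le> min pi (pi / \<rho>)"
    and "z \<noteq> 0"
    and "pi / (2 * \<rho>) - \<delta>2 + pi < Arg2pi z"
    and "Arg2pi z < - pi / (2 * \<rho>) + \<delta>1 + pi"
  shows "(\<lambda>r. K_ml \<rho> \<mu> r (- \<delta>1) \<delta>2 z) integrable_on {1 + \<epsilon>..}
    \<and> (\<lambda>\<phi>. P_ml \<rho> \<mu> (1 + \<epsilon>) \<phi> z) integrable_on {- \<delta>1 - pi..\<delta>2 - pi}
    \<and> mittag_leffler \<rho> \<mu> z =
        integral {1 + \<epsilon>..} (\<lambda>r. K_ml \<rho> \<mu> r (- \<delta>1) \<delta>2 z)
        + integral {- \<delta>1 - pi..\<delta>2 - pi} (\<lambda>\<phi>. P_ml \<rho> \<mu> (1 + \<epsilon>) \<phi> z)"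
proof -
  define R where "R = 1 + \<epsilon>"
  define m where "m = cmod z"
  define \<theta> where "\<theta> = Arg2pi z"
  define \<phi>1 where "\<phi>1 = - \<delta>1 - pi"
  define \<phi>2 where "\<phi>2 = \<delta>2 - pi"
  define w where "w = (\<lambda>r \<phi>. of_real (\<rho> * ln (m * r)) + \<i> * of_real (\<rho> * (\<theta> + \<phi>)) :: complex)"
  \<comment> \<open>\<open>q r \<phi>\<close> is the ratio \<open>z / \<zeta>\<close>.\<close>
  define q where "q = (\<lambda>r \<phi>. exp (- (\<i> * of_real \<phi>)) / of_real r :: complex)"
  define ray where "ray = (\<lambda>s \<phi> r. of_real (\<rho> / r) * hankel_integrand s (w r \<phi>))"
  define arc where "arc = (\<lambda>s \<phi>. \<i> * of_real \<rho> * hankel_integrand s (w R \<phi>))"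
  define s where "s = (\<lambda>k. \<mu> + of_real (real k / \<rho>))"
  have \<rho>: "\<rho> > 0" and m: "m > 0" and R: "R > 1" and R0: "R > 0"
    using assms by (auto simp: R_def m_def)
  have le: "\<phi>1 \<le> \<phi>2"
    using assms \<rho> pi_gt_zero unfolding \<phi>1_def \<phi>2_def
    by (smt (verit) divide_pos_pos mult_pos_pos)
  \<comment> \<open>The hypotheses, multiplied by \<open>\<rho>\<close>, place both rays in the sectors where Hankel's formula holds.\<close>
  have scaled: "pi / 2 - \<rho> * \<delta>2 + \<rho> * pi < \<rho> * \<theta>" "\<rho> * \<theta> < - (pi / 2) + \<rho> * \<delta>1 + \<rho> * pi"
      "\<rho> * \<delta>1 \<le> pi" "\<rho> * \<delta>2 \<le> pi"
  proof -
    have half: "\<rho> * (pi / (2 * \<rho>)) = pi / 2" "\<rho> * (- pi / (2 * \<rho>)) = - (pi / 2)"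
      using \<rho> by simp_all
    show "pi / 2 - \<rho> * \<delta>2 + \<rho> * pi < \<rho> * \<theta>"
      using mult_strict_left_mono[OF assms(8) \<rho>]
      by (simp only: distrib_left right_diff_distrib half \<theta>_def)
    show "\<rho> * \<theta> < - (pi / 2) + \<rho> * \<delta>1 + \<rho> * pi"
      using mult_strict_left_mono[OF assms(9) \<rho>]
      by (simp only: distrib_left half \<theta>_def)
    show "\<rho> * \<delta>1 \<le> pi" "\<rho> * \<delta>2 \<le> pi"
      using assms(4,6) \<rho> by (simp_all add: field_simps)
  qed
  have up: "pi / 2 < \<rho> * (\<theta> + \<phi>2)" "\<rho> * (\<theta> + \<phi>2) < 3 * pi / 2"
    and lo: "- (3 * pi / 2) < \<rho> * (\<theta> + \<phi>1)" "\<rho> * (\<theta> + \<phi>1) < - (pi / 2)"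
    using scaled by (simp_all add: \<phi>1_def \<phi>2_def algebra_simps)
  have neg: "cos (\<rho> * (\<theta> + \<phi>1)) < 0" "cos (\<rho> * (\<theta> + \<phi>2)) < 0"
    by (rule cos_neg_left_half_plane; use up lo in simp)+

  have z: "z = exp (of_real (ln m) + \<i> * of_real \<theta>)"
    using Arg2pi_eq[of z] m by (simp add: m_def \<theta>_def exp_add exp_of_real)
  have power: "hankel_integrand \<mu> (w r \<phi>) * q r \<phi> ^ k = z ^ k * hankel_integrand (s k) (w r \<phi>)"
    if "r > 0" for r \<phi> k
  proof -
    have w: "w r \<phi> = of_real \<rho> * ((of_real (ln m) + \<i> * of_real \<theta>) + (of_real (ln r) + \<i> * of_real \<phi>))"
      using that m by (simp add: w_def ln_mult algebra_simps)
    have q: "q r \<phi> = exp (- (of_real (ln r) + \<i> * of_real \<phi>))"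
      using that by (simp add: q_def exp_diff exp_minus exp_of_real field_simps)
    show ?thesis
      unfolding w q z s_def by (rule hankel_integrand_times_power) (use \<rho> in simp)
  qed
  have q_le: "norm (q r \<phi>) \<le> 1 / R" if "r \<ge> R" for r \<phi>
    using that R by (simp add: q_def norm_divide frac_le)

  have "\<exists>I1 I2 J. (ray (s k) \<phi>1 has_integral I1) {R..} \<and> (ray (s k) \<phi>2 has_integral I2) {R..}
      \<and> (arc (s k) has_integral J) {\<phi>1..\<phi>2} \<and> I2 - I1 + J = 2 * of_real pi * \<i> * rGamma (s k)" for k
    unfolding ray_def arc_def w_def using rGamma_hankel_contour[OF \<rho> m R0 le up lo] by blast
  then obtain I1 I2 J where I: "\<And>k. (ray (s k) \<phi>1 has_integral I1 k) {R..}"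
      "\<And>k. (ray (s k) \<phi>2 has_integral I2 k) {R..}" "\<And>k. (arc (s k) has_integral J k) {\<phi>1..\<phi>2}"
      and sum: "\<And>k. I2 k - I1 k + J k = 2 * of_real pi * \<i> * rGamma (s k)"
    by metis

  have ray: "(\<lambda>r. ray \<mu> \<phi> r / (1 - q r \<phi>)) integrable_on {R..}"
      "(\<lambda>k. z ^ k * I k) sums integral {R..} (\<lambda>r. ray \<mu> \<phi> r / (1 - q r \<phi>))"
    if neg: "cos (\<rho> * (\<theta> + \<phi>)) < 0" and I: "\<And>k. (ray (s k) \<phi> has_integral I k) {R..}" for \<phi> I
  proof -
    have int: "((\<lambda>r. ray \<mu> \<phi> r * q r \<phi> ^ k) has_integral z ^ k * I k) {R..}" for k
    proof (rule has_integral_eq[OF _ has_integral_mult_right[OF I]])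
      fix r assume "r \<in> {R..}"
      then show "z ^ k * ray (s k) \<phi> r = ray \<mu> \<phi> r * q r \<phi> ^ k"
        using power[of r \<phi> k] R by (simp add: ray_def mult.left_commute mult.assoc)
    qed
    obtain C where "\<And>r. r \<ge> R \<Longrightarrow> norm (ray \<mu> \<phi> r) \<le> C * (1 / r\<^sup>2)"
      using hankel_ray_bound[OF \<rho> m R0 neg] unfolding ray_def w_def by blast
    then show "(\<lambda>r. ray \<mu> \<phi> r / (1 - q r \<phi>)) integrable_on {R..}"
      "(\<lambda>k. z ^ k * I k) sums integral {R..} (\<lambda>r. ray \<mu> \<phi> r / (1 - q r \<phi>))"
      using integral_geometric_series_sums[OF int inverse_square_integrable[OF R0], of C "1 / R"] q_le R
      by auto
  qed
  have arc: "(\<lambda>\<phi>. arc \<mu> \<phi> / (1 - q R \<phi>)) integrable_on {\<phi>1..\<phi>2}"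
      "(\<lambda>k. z ^ k * J k) sums integral {\<phi>1..\<phi>2} (\<lambda>\<phi>. arc \<mu> \<phi> / (1 - q R \<phi>))"
  proof -
    have int: "((\<lambda>\<phi>. arc \<mu> \<phi> * q R \<phi> ^ k) has_integral z ^ k * J k) {\<phi>1..\<phi>2}" for k
    proof (rule has_integral_eq[OF _ has_integral_mult_right[OF I(3)]])
      fix \<phi>
      show "z ^ k * arc (s k) \<phi> = arc \<mu> \<phi> * q R \<phi> ^ k"
        using power[of R \<phi> k] R by (simp add: arc_def mult.left_commute mult.assoc)
    qed
    have "continuous_on {\<phi>1..\<phi>2} (arc \<mu>)"
      unfolding arc_def hankel_integrand_def w_def by (intro continuous_intros)
    then have "bounded (arc \<mu> ` {\<phi>1..\<phi>2})"
      by (intro compact_imp_bounded compact_continuous_image) auto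
    then obtain B where "\<forall>x\<in>arc \<mu> ` {\<phi>1..\<phi>2}. norm x \<le> B"
      unfolding bounded_iff by blast
    then show "(\<lambda>\<phi>. arc \<mu> \<phi> / (1 - q R \<phi>)) integrable_on {\<phi>1..\<phi>2}"
      "(\<lambda>k. z ^ k * J k) sums integral {\<phi>1..\<phi>2} (\<lambda>\<phi>. arc \<mu> \<phi> / (1 - q R \<phi>))"
      using integral_geometric_series_sums[OF int integrable_const_ivl, of B "1 / R"] q_le[OF order_refl] R
      by auto
  qed

  let ?c = "1 / (2 * of_real pi * \<i>) :: complex"
  let ?f = "\<lambda>\<phi> r. ray \<mu> \<phi> r / (1 - q r \<phi>)" and ?a = "\<lambda>\<phi>. arc \<mu> \<phi> / (1 - q R \<phi>)"
  note ray1 = ray[OF neg(1) I(1)] and ray2 = ray[OF neg(2) I(2)]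
  have K: "K_ml \<rho> \<mu> r (- \<delta>1) \<delta>2 z = ?c * (?f \<phi>2 r - ?f \<phi>1 r)" if "r \<in> {R..}" for r
    using K_ml_eq_hankel[of r \<rho> \<mu> "- \<delta>1" \<delta>2 z] that R
    by (simp add: ray_def w_def q_def m_def \<theta>_def \<phi>1_def \<phi>2_def)
  have P: "P_ml \<rho> \<mu> R \<phi> z = ?c * ?a \<phi>" for \<phi>
    using P_ml_eq_hankel[OF R, of \<rho> \<mu> \<phi> z] by (simp add: arc_def w_def q_def m_def \<theta>_def)
  have K_int: "((\<lambda>r. K_ml \<rho> \<mu> r (- \<delta>1) \<delta>2 z) has_integral
      ?c * (integral {R..} (?f \<phi>2) - integral {R..} (?f \<phi>1))) {R..}"
    by (rule has_integral_eq[OF K[symmetric]], assumption)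
      (intro has_integral_mult_right has_integral_diff integrable_integral ray1 ray2)
  have P_int: "((\<lambda>\<phi>. P_ml \<rho> \<mu> R \<phi> z) has_integral ?c * integral {\<phi>1..\<phi>2} ?a) {\<phi>1..\<phi>2}"
    unfolding P by (intro has_integral_mult_right integrable_integral arc)
  have "(\<lambda>k. ?c * (z ^ k * I2 k - z ^ k * I1 k) + ?c * (z ^ k * J k)) sums
      (?c * (integral {R..} (?f \<phi>2) - integral {R..} (?f \<phi>1)) + ?c * integral {\<phi>1..\<phi>2} ?a)"
    by (intro sums_add sums_mult sums_diff ray1 ray2 arc)
  moreover have "?c * (z ^ k * I2 k - z ^ k * I1 k) + ?c * (z ^ k * J k) =
      z ^ k * rGamma (\<mu> + of_real (real k / \<rho>))" for k
  proof -
    have "?c * (z ^ k * I2 k - z ^ k * I1 k) + ?c * (z ^ k * J k) = ?c * z ^ k * (I2 k - I1 k + J k)"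
      by (simp only: distrib_left right_diff_distrib mult.assoc)
    also have "\<dots> = (?c * (2 * of_real pi * \<i>)) * (z ^ k * rGamma (s k))"
      unfolding sum by (simp only: mult_ac)
    also have "?c * (2 * of_real pi * \<i>) = 1"
      by simp
    finally show ?thesis
      by (simp only: s_def mult_1_left)
  qed
  ultimately have "mittag_leffler \<rho> \<mu> z =
      ?c * (integral {R..} (?f \<phi>2) - integral {R..} (?f \<phi>1)) + ?c * integral {\<phi>1..\<phi>2} ?a"
    unfolding mittag_leffler_def using sums_unique by (metis (no_types, lifting) sums_cong)
  then show ?thesis
    using K_int P_int integral_unique[OF K_int] integral_unique[OF P_int]
    unfolding R_def \<phi>1_def \<phi>2_def by (auto simp: integrable_on_def)
qed

end
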